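(* Let $X$ and $Y$ be complete separable metric spaces, let $G:X\to Y$ be a measurable, proper mapping of $X$ onto $Y$, and let $\pi$ be a Papangelou kernel on $X$ satisfying Dynkin's condition $(\mathcal D)$: for all $\mu_1,\mu_2\in\mathcal M^{\cdot\cdot}(X)$ and all continuous $f:Y\to\mathbb R$ with bounded support, $G\mu_1=G\mu_2$ implies $\int f\circ G\,\mathrm d\pi(\mu_1,\cdot)=\int f\circ G\,\mathrm d\pi(\mu_2,\cdot)$. Let $\pi'$ be the Radon kernel from $\mathcal M^{\cdot\cdot}(Y)$ to $Y$ given by $\pi'(\nu,B)=\pi(\mu,G^{-1}(B))$ whenever $\mu\in\mathcal M^{\cdot\cdot}(X)$ with $G\mu=\nu$, for $B\in\mathcal B(Y)$. If $\mathsf P\in\wp(\pi)$, then $G\mathsf P\in\wp(\pi')$.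
   Context: For a complete separable metric space $X$ with Borel $\sigma$-field $\mathcal B(X)$ let $\mathcal B_0(X)$ be the ring of (metrically) bounded Borel sets. $\mathcal M(X)$ is the set of Radon measures, meaning Borel measures finite on every $B\in\mathcal B_0(X)$. $\mathcal M^{\cdot\cdot}(X)\subset\mathcal M(X)$ is the measurable subset of point measures, i.e. those $\mu\in\mathcal M(X)$ with $\mu(B)\in\mathbb N\cup\{+\infty\}$ for all $B\in\mathcal B(X)$. These spaces carry the $\sigma$-field generated by the evaluations $\mu\mapsto\mu(B)$. A point process on $X$ is a probability measure on $\mathcal M^{\cdot\cdot}(X)$. A Radon kernel from $\mathcal M^{\cdot\cdot}(X)$ to $X$ assigns to $\mu\in\mathcal M^{\cdot\cdot}(X)$ and $B\in\mathcal B(X)$ a nonnegative value $\pi(\mu,B)$ such that $\pi(\mu,\cdot)\in\mathcal M(X)$ for each $\mu$, and $\mu\mapsto\pi(\mu,B)$ is measurable for each $B$. A Papangelou process specified by the Radon kernel $\pi$ is a point process $\mathsf P$ such that for all nonnegative measurable $h$ on $X\times\mathcal M^{\cdot\cdot}(X)$ $$\iint h(x,\mu)\,\mu(\mathrm dx)\,\mathsf P(\mathrm d\mu)=\iint h(x,\mu+\delta_x)\,\pi(\mu,\mathrm dx)\,\mathsf P(\mathrm d\mu).$$ In this case $\pi$ is called a Papangelou kernel. $\wp(\pi)$ denotes the set of all Papangelou processes specified by $\pi$. A measurable $G:X\to Y$ is proper if $G^{-1}(B)\in\mathcal B_0(X)$ for all $B\in\mathcal B_0(Y)$. For $\mu\in\mathcal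 M(X)$, $G\mu$ is the image measure $G\mu(B)=\mu(G^{-1}(B))$, and $G\mathsf P$ is the image of $\mathsf P$ under $\mu\mapsto G\mu$. Condition $(\mathcal D)$ ensures that the defining relation of $\pi'$ does not depend on the choice of $\mu$ with $G\mu=\nu$; if some $\nu\in\mathcal M^{\cdot\cdot}(Y)$ is not of the form $G\mu$, then $\pi'$ is any Radon kernel satisfying $\pi'(G\mu,B)=\pi(\mu,G^{-1}(B))$ for all $\mu\in\mathcal M^{\cdot\cdot}(X)$ and $B\in\mathcal B(Y)$. *)

theory Defs
  imports "HOL-Probability.Probability"
begin

definition radon_measures :: "'a::polish_space measure set" where
  "radon_measures =
    {\<mu>. sets \<mu> = sets borel \<and> (\<forall>B\<in>sets borel. bounded B \<longrightarrow> emeasure \<mu> B < \<infinity>)}"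

definition point_measures :: "'a::polish_space measure set" where
  "point_measures =
    {\<mu> \<in> radon_measures. \<forall>B\<in>sets borel. emeasure \<mu> B \<in> range of_nat \<union> {\<infinity>}}"

text \<open>The \<sigma>-fields generated by the evaluations, encoded as for the library's
  \<^const>\<open>subprob_algebra\<close>.\<close>

definition radon_algebra :: "'a::polish_space measure measure" where
  "radon_algebra =
    (SUP B \<in> sets borel. vimage_algebra radon_measures (\<lambda>\<mu>. emeasure \<mu> B) borel)"

definition point_algebra :: "'a::polish_space measure measure" where
  "point_algebra = restrict_space radon_algebra point_measures"

lemma space_radon_algebra: "space radon_algebra = radon_measures"
  unfolding radon_algebra_def by (subst space_Sup_eq_UN) auto

lemma point_measures_subset: "point_measures \<subseteq> radon_measures"
  by (auto simp: point_measures_def)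

lemma space_point_algebra: "space point_algebra = point_measures"
  using point_measures_subset
  by (auto simp: point_algebra_def space_restrict_space space_radon_algebra)

definition point_process :: "'a::polish_space measure measure \<Rightarrow> bool" where
  "point_process P \<longleftrightarrow> sets P = sets point_algebra \<and> prob_space P"

definition add_measure :: "'a measure \<Rightarrow> 'a measure \<Rightarrow> 'a measure" where
  "add_measure M N = measure_of (space M) (sets M) (\<lambda>A. emeasure M A + emeasure N A)"

lemma sets_add_measure: "sets (add_measure M N) = sets M"
  by (simp add: add_measure_def)

lemma emeasure_add_measure:
  assumes "sets N = sets M" "A \<in> sets M"
  shows "emeasure (add_measure M N) A = emeasure M A + emeasure N A"
proof (rule emeasure_measure_of[OF add_measure_def])
  show "countably_additive (sets (add_measure M N)) (\<lambda>A. emeasure M A + emeasure N A)"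
    unfolding countably_additive_def sets_add_measure
  proof (intro allI impI)
    fix F :: "nat \<Rightarrow> 'a set"
    assume F: "range F \<subseteq> sets M" "disjoint_family F"
    then show "(\<Sum>i. emeasure M (F i) + emeasure N (F i)) =
        emeasure M (\<Union>i. F i) + emeasure N (\<Union>i. F i)"
      using assms(1) by (simp add: suminf_add[symmetric] suminf_emeasure)
  qed
qed (use assms in \<open>auto simp: positive_def sets_add_measure dest: sets.sets_into_space\<close>)

definition radon_kernel ::
    "('a::polish_space measure \<Rightarrow> 'b::polish_space measure) \<Rightarrow> bool" where
  "radon_kernel \<pi> \<longleftrightarrow>
    (\<forall>\<mu>\<in>point_measures. \<pi> \<mu> \<in> radon_measures) \<and>
    (\<forall>B\<in>sets borel. (\<lambda>\<mu>. emeasure (\<pi> \<mu>) B) \<in> borel_measurable point_algebra)"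

text \<open>The set \<open>\<wp>(\<pi>)\<close>; \<^term>\<open>return borel x\<close> is the Dirac measure at \<open>x\<close>.\<close>

definition papangelou_processes ::
    "('a::polish_space measure \<Rightarrow> 'a measure) \<Rightarrow> 'a measure measure set" where
  "papangelou_processes \<pi> =
    {P. radon_kernel \<pi> \<and> point_process P \<and>
      (\<forall>h :: 'a \<times> 'a measure \<Rightarrow> ennreal. h \<in> borel_measurable (borel \<Otimes>\<^sub>M point_algebra) \<longrightarrow>
        (\<integral>\<^sup>+\<mu>. (\<integral>\<^sup>+x. h (x, \<mu>) \<partial>\<mu>) \<partial>P) =
        (\<integral>\<^sup>+\<mu>. (\<integral>\<^sup>+x. h (x, add_measure \<mu> (return borel x)) \<partial>\<pi> \<mu>) \<partial>P))}"

definition papangelou_kernel :: "('a::polish_space measure \<Rightarrow> 'a measure) \<Rightarrow> bool" where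
  "papangelou_kernel \<pi> \<longleftrightarrow> radon_kernel \<pi> \<and> papangelou_processes \<pi> \<noteq> {}"

definition bounded_proper :: "('a::polish_space \<Rightarrow> 'b::polish_space) \<Rightarrow> bool" where
  "bounded_proper G \<longleftrightarrow>
    (\<forall>B\<in>sets borel. bounded B \<longrightarrow> G -` B \<in> sets borel \<and> bounded (G -` B))"

definition image_measure ::
    "('a::polish_space \<Rightarrow> 'b::polish_space) \<Rightarrow> 'a measure \<Rightarrow> 'b measure" where
  "image_measure G \<mu> = distr \<mu> borel G"

definition image_process ::
    "('a::polish_space \<Rightarrow> 'b::polish_space) \<Rightarrow> 'a measure measure \<Rightarrow> 'b measure measure" where
  "image_process G P = distr P point_algebra (image_measure G)"

text \<open>A continuous \<open>f\<close> with bounded support need not be bounded, so the integrals below may fail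
  to exist (the Bochner integral is then \<open>0\<close>). This does not affect the condition: the instances
  with bounded \<open>f\<close>, where both integrals exist, already force the images of \<open>\<pi> \<mu>\<^sub>1\<close> and
  \<open>\<pi> \<mu>\<^sub>2\<close> under \<open>G\<close> to coincide, for \<open>G\<close> measurable and proper and \<open>\<pi>\<close> a Radon kernel.\<close>

definition dynkin_condition ::
    "('a::polish_space \<Rightarrow> 'b::polish_space) \<Rightarrow> ('a measure \<Rightarrow> 'a measure) \<Rightarrow> bool" where
  "dynkin_condition G \<pi> \<longleftrightarrow>
    (\<forall>\<mu>\<^sub>1\<in>point_measures. \<forall>\<mu>\<^sub>2\<in>point_measures. \<forall>f :: 'b \<Rightarrow> real.
      continuous_on UNIV f \<longrightarrow> bounded (closure {y. f y \<noteq> 0}) \<longrightarrow>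
      image_measure G \<mu>\<^sub>1 = image_measure G \<mu>\<^sub>2 \<longrightarrow>
      (LINT x|\<pi> \<mu>\<^sub>1. (f \<circ> G) x) = (LINT x|\<pi> \<mu>\<^sub>2. (f \<circ> G) x))"

text \<open>\<open>\<pi>'\<close> is determined on the images \<open>G\<mu>\<close> only; elsewhere it is an arbitrary Radon kernel,
  so this is a property of \<open>\<pi>'\<close> and not a function of \<open>G\<close> and \<open>\<pi>\<close>.\<close>

definition image_kernel ::
    "('a::polish_space \<Rightarrow> 'b::polish_space) \<Rightarrow> ('a measure \<Rightarrow> 'a measure) \<Rightarrow>
      ('b measure \<Rightarrow> 'b measure) \<Rightarrow> bool" where
  "image_kernel G \<pi> \<pi>' \<longleftrightarrow> radon_kernel \<pi>' \<and>
    (\<forall>\<nu>\<in>point_measures. \<forall>\<mu>\<in>point_measures. image_measure G \<mu> = \<nu> \<longrightarrow>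
      (\<forall>B\<in>sets borel. emeasure (\<pi>' \<nu>) B = emeasure (\<pi> \<mu>) (G -` B)))"

end

theory Submission
  imports Defs
begin

text \<open>Since \<open>G(\<mu> + \<delta>\<^sub>x) = G\<mu> + \<delta>\<^bsub>Gx\<^esub>\<close>, the defining relation of \<open>G\<P>\<close> for a test function
  \<open>h\<close> is that of \<open>\<P>\<close> for the test function \<open>(x, \<mu>) \<mapsto> h (Gx, G\<mu>)\<close>, once \<open>\<pi>'(G\<mu>)\<close> is recognised
  as the image of \<open>\<pi>(\<mu>)\<close> under \<open>G\<close>. The change of variables needs the measurability of integrals
  against locally finite kernels, which is reduced to finite ones by exhausting the space by
  balls.\<close>

section \<open>Radon measures, point measures and their evaluations\<close>

lemma sets_radon: "\<mu> \<in> radon_measures \<Longrightarrow> sets \<mu> = sets borel"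
  by (simp add: radon_measures_def)

lemma space_radon: "\<mu> \<in> radon_measures \<Longrightarrow> space \<mu> = UNIV"
  using sets_eq_imp_space_eq[OF sets_radon] by force

lemma emeasure_radon_finite:
  "\<mu> \<in> radon_measures \<Longrightarrow> B \<in> sets borel \<Longrightarrow> bounded B \<Longrightarrow> emeasure \<mu> B < \<infinity>"
  by (simp add: radon_measures_def)

lemma point_measure_radon: "\<mu> \<in> point_measures \<Longrightarrow> \<mu> \<in> radon_measures"
  using point_measures_subset by auto

lemmas sets_point_measure = sets_radon[OF point_measure_radon]

lemma measurable_emeasure_point_algebra:
  assumes "B \<in> sets borel"
  shows "(\<lambda>\<mu>. emeasure \<mu> B) \<in> borel_measurable point_algebra"
  unfolding point_algebra_def radon_algebra_def
  using assms by (auto intro!: measurable_restrict_space1 measurable_Sup1 measurable_vimage_algebra1)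

text \<open>The universal property of the sigma-field generated by the evaluations: a supremum of
  pulled-back sigma-fields, restricted to \<open>point_measures\<close>, is tested one evaluation at
  a time. All later measurability claims for maps into \<open>point_algebra\<close> go through this
  criterion.\<close>

lemma measurable_point_algebra:
  assumes "\<And>\<omega>. \<omega> \<in> space M \<Longrightarrow> f \<omega> \<in> point_measures"
    and "\<And>B. B \<in> sets borel \<Longrightarrow> (\<lambda>\<omega>. emeasure (f \<omega>) B) \<in> borel_measurable M"
  shows "f \<in> measurable M point_algebra"
  unfolding point_algebra_def radon_algebra_def
  using assms point_measure_radon
  by (auto intro!: measurable_restrict_space2 measurable_Sup2 measurable_vimage_algebra2)

section \<open>Measurability of integrals against locally finite kernels\<close>

text \<open>A Dynkin-system argument starting from measurable rectangles. Cutting with the bounded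
  set \<open>C\<close> keeps all measures finite, which is what makes subtraction legitimate in the
  complement case.\<close>

lemma measurable_kernel_section_bounded:
  fixes K :: "'c \<Rightarrow> 'a::polish_space measure"
  assumes K: "\<And>\<omega>. \<omega> \<in> space M \<Longrightarrow> K \<omega> \<in> radon_measures"
    and meas: "\<And>B. B \<in> sets borel \<Longrightarrow> (\<lambda>\<omega>. emeasure (K \<omega>) B) \<in> borel_measurable M"
    and C: "C \<in> sets borel" "bounded C"
    and A: "A \<in> sets (borel \<Otimes>\<^sub>M M)"
  shows "(\<lambda>\<omega>. emeasure (K \<omega>) (C \<inter> (\<lambda>x. (x, \<omega>)) -` A)) \<in> borel_measurable M"
proof -
  have sec: "(\<lambda>x. (x, \<omega>)) -` A \<in> sets borel"
    if "A \<in> sets (borel \<Otimes>\<^sub>M M)" for A :: "('a \<times> 'c) set" and \<omega>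
    using sets_Pair2[OF that] by simp
  from Int_stable_pair_measure_generator pair_measure_closed A[unfolded sets_pair_measure]
  show ?thesis
  proof (induction A rule: sigma_sets_induct_disjoint)
    case (basic A)
    then obtain a b where ab: "A = a \<times> b" "a \<in> sets borel" "b \<in> sets M" by auto
    \<comment> \<open>The section of \<open>a \<times> b\<close> at \<open>\<omega>\<close> is
      \<open>a\<close> if \<open>\<omega>\<close> lies in \<open>b\<close> and empty otherwise, so
      the dependence on \<open>\<omega>\<close> splits off as an indicator.\<close>
    have "(\<lambda>\<omega>. emeasure (K \<omega>) (C \<inter> a) * indicator b \<omega>) \<in> borel_measurable M"
      using ab C by (intro borel_measurable_times_ennreal meas borel_measurable_indicator) auto
    also have "(\<lambda>\<omega>. emeasure (K \<omega>) (C \<inter> a) * indicator b \<omega>) =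
        (\<lambda>\<omega>. emeasure (K \<omega>) (C \<inter> (\<lambda>x. (x, \<omega>)) -` A))"
      by (auto simp: fun_eq_iff ab indicator_def vimage_def)
    finally show ?case .
  next
    case empty
    show ?case by simp
  next
    case (compl A)
    then have A: "A \<in> sets (borel \<Otimes>\<^sub>M M)" by (simp add: sets_pair_measure)
    have "(\<lambda>\<omega>. emeasure (K \<omega>) C - emeasure (K \<omega>) (C \<inter> (\<lambda>x. (x, \<omega>)) -` A)) \<in> borel_measurable M"
      using compl meas C by (intro borel_measurable_minus_ennreal) auto
    also have "?this \<longleftrightarrow> ?case"
    proof (rule measurable_cong)
      fix \<omega> assume \<omega>: "\<omega> \<in> space M"
      \<comment> \<open>The complement is taken inside \<open>space borel \<times> space M\<close>;
        its section is the full complement of the section of \<open>A\<close> only because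
        \<open>\<omega>\<close> lies in \<open>space M\<close>.\<close>
      have "C \<inter> (\<lambda>x. (x, \<omega>)) -` (space borel \<times> space M - A) = C - C \<inter> (\<lambda>x. (x, \<omega>)) -` A"
        using \<omega> by auto
      then show "emeasure (K \<omega>) C - emeasure (K \<omega>) (C \<inter> (\<lambda>x. (x, \<omega>)) -` A) =
          emeasure (K \<omega>) (C \<inter> (\<lambda>x. (x, \<omega>)) -` (space borel \<times> space M - A))"
        using C sec[OF A, of \<omega>] K[OF \<omega>] emeasure_radon_finite[OF K[OF \<omega>], of "C \<inter> (\<lambda>x. (x, \<omega>)) -` A"]
        by (subst emeasure_Diff[symmetric]) (auto simp: sets_radon bounded_Int)
    qed
    finally show ?case .
  next
    case (union F)
    then have F: "F i \<in> sets (borel \<Otimes>\<^sub>M M)" for i by (auto simp: sets_pair_measure)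
    have "(\<lambda>\<omega>. \<Sum>i. emeasure (K \<omega>) (C \<inter> (\<lambda>x. (x, \<omega>)) -` F i)) \<in> borel_measurable M"
      using union by (intro borel_measurable_suminf_order) auto
    also have "?this \<longleftrightarrow> ?case"
    proof (rule measurable_cong)
      fix \<omega> assume \<omega>: "\<omega> \<in> space M"
      have "disjoint_family (\<lambda>i. C \<inter> (\<lambda>x. (x, \<omega>)) -` F i)"
        using union(1) unfolding disjoint_family_on_def by blast
      then have "(\<Sum>i. emeasure (K \<omega>) (C \<inter> (\<lambda>x. (x, \<omega>)) -` F i)) =
          emeasure (K \<omega>) (\<Union>i. C \<inter> (\<lambda>x. (x, \<omega>)) -` F i)"
        using C sec[OF F] sets_radon[OF K[OF \<omega>]] by (intro suminf_emeasure) auto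
      also have "(\<Union>i. C \<inter> (\<lambda>x. (x, \<omega>)) -` F i) = C \<inter> (\<lambda>x. (x, \<omega>)) -` (\<Union>i. F i)"
        by auto
      finally show "(\<Sum>i. emeasure (K \<omega>) (C \<inter> (\<lambda>x. (x, \<omega>)) -` F i)) =
          emeasure (K \<omega>) (C \<inter> (\<lambda>x. (x, \<omega>)) -` (\<Union>i. F i))" .
    qed
    finally show ?case .
  qed
qed

text \<open>Continuity from below along an exhaustion by bounded sets removes the cut-off. The limit
  may be infinite, so the complement step could not have been run directly.\<close>

lemma measurable_kernel_section:
  fixes K :: "'c \<Rightarrow> 'a::polish_space measure"
  assumes K: "\<And>\<omega>. \<omega> \<in> space M \<Longrightarrow> K \<omega> \<in> radon_measures"
    and meas: "\<And>B. B \<in> sets borel \<Longrightarrow> (\<lambda>\<omega>. emeasure (K \<omega>) B) \<in> borel_measurable M"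
    and A: "A \<in> sets (borel \<Otimes>\<^sub>M M)"
  shows "(\<lambda>\<omega>. emeasure (K \<omega>) ((\<lambda>x. (x, \<omega>)) -` A)) \<in> borel_measurable M"
proof -
  \<comment> \<open>The centre is arbitrary: closed balls of radius \<open>n\<close> around any
    fixed point are Borel, bounded and increasing, and they cover the space by the Archimedean
    property.\<close>
  define C where "C n = cball (undefined :: 'a) (real n)" for n
  have C: "C n \<in> sets borel" "bounded (C n)" for n by (auto simp: C_def)
  have mono: "C m \<subseteq> C n" if "m \<le> n" for m n
    unfolding C_def using that by (intro subset_cball) simp
  have "\<exists>n. x \<in> C n" for x
    unfolding C_def mem_cball by (rule real_arch_simple)
  then have UN: "(\<Union>n. C n) = UNIV" by auto
  have "(\<lambda>\<omega>. SUP n. emeasure (K \<omega>) (C n \<inter> (\<lambda>x. (x, \<omega>)) -` A)) \<in> borel_measurable M"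
    using measurable_kernel_section_bounded[OF K meas C A] by (intro borel_measurable_SUP) auto
  also have "?this \<longleftrightarrow> ?thesis"
  proof (rule measurable_cong)
    fix \<omega> assume \<omega>: "\<omega> \<in> space M"
    have sec: "(\<lambda>x. (x, \<omega>)) -` A \<in> sets borel"
      using sets_Pair2[OF A] by simp
    have "(SUP n. emeasure (K \<omega>) (C n \<inter> (\<lambda>x. (x, \<omega>)) -` A)) =
        emeasure (K \<omega>) (\<Union>n. C n \<inter> (\<lambda>x. (x, \<omega>)) -` A)"
    proof (rule SUP_emeasure_incseq)
      show "range (\<lambda>n. C n \<inter> (\<lambda>x. (x, \<omega>)) -` A) \<subseteq> sets (K \<omega>)"
        unfolding sets_radon[OF K[OF \<omega>]] using C sec by blast
      show "incseq (\<lambda>n. C n \<inter> (\<lambda>x. (x, \<omega>)) -` A)"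
        unfolding incseq_def using mono by blast
    qed
    also have "(\<Union>n. C n \<inter> (\<lambda>x. (x, \<omega>)) -` A) = (\<lambda>x. (x, \<omega>)) -` A"
      using UN by blast
    finally show "(SUP n. emeasure (K \<omega>) (C n \<inter> (\<lambda>x. (x, \<omega>)) -` A)) =
        emeasure (K \<omega>) ((\<lambda>x. (x, \<omega>)) -` A)" .
  qed
  finally show ?thesis .
qed

text \<open>The usual extension from indicators through multiples and sums to monotone limits. The
  kernel is a family over an arbitrary \<open>M\<close>, so that one statement serves both the
  tautological kernel \<open>\<nu> \<mapsto> \<nu>\<close> and \<open>\<pi>'\<close>, the two
  kernels integrated on the target space.\<close>

lemma measurable_nn_integral_kernel:
  fixes K :: "'c \<Rightarrow> 'a::polish_space measure"
  assumes K: "\<And>\<omega>. \<omega> \<in> space M \<Longrightarrow> K \<omega> \<in> radon_measures"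
    and meas: "\<And>B. B \<in> sets borel \<Longrightarrow> (\<lambda>\<omega>. emeasure (K \<omega>) B) \<in> borel_measurable M"
    and f: "f \<in> borel_measurable (borel \<Otimes>\<^sub>M M)"
  shows "(\<lambda>\<omega>. \<integral>\<^sup>+x. f (x, \<omega>) \<partial>K \<omega>) \<in> borel_measurable M"
proof -
  have sec: "(\<lambda>x. g (x, \<omega>)) \<in> borel_measurable (K \<omega>)"
    if "g \<in> borel_measurable (borel \<Otimes>\<^sub>M M)" "\<omega> \<in> space M" for g :: "'a \<times> 'c \<Rightarrow> ennreal" and \<omega>
    using measurable_Pair1[OF that] sets_radon[OF K[OF that(2)]]
    by (simp cong: measurable_cong_sets)
  from f show ?thesis
  proof (induction rule: borel_measurable_induct)
    case (cong f g)
    have "(\<lambda>\<omega>. \<integral>\<^sup>+x. f (x, \<omega>) \<partial>K \<omega>) \<in> borel_measurable M \<longleftrightarrow>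
        (\<lambda>\<omega>. \<integral>\<^sup>+x. g (x, \<omega>) \<partial>K \<omega>) \<in> borel_measurable M"
      using cong(3) by (intro measurable_cong nn_integral_cong) (auto simp: space_pair_measure)
    with cong show ?case by simp
  next
    case (set A)
    have "(\<lambda>\<omega>. emeasure (K \<omega>) ((\<lambda>x. (x, \<omega>)) -` A)) \<in> borel_measurable M"
      using K meas set by (rule measurable_kernel_section)
    also have "?this \<longleftrightarrow> ?case"
    proof (rule measurable_cong)
      fix \<omega> assume \<omega>: "\<omega> \<in> space M"
      have "(\<lambda>x. (x, \<omega>)) -` A \<in> sets (K \<omega>)"
        using sets_Pair2[OF set] sets_radon[OF K[OF \<omega>]] by simp
      moreover have "(\<lambda>x. indicator A (x, \<omega>) :: ennreal) = indicator ((\<lambda>x. (x, \<omega>)) -` A)"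
        by (auto simp: indicator_def)
      ultimately show "emeasure (K \<omega>) ((\<lambda>x. (x, \<omega>)) -` A) = (\<integral>\<^sup>+x. indicator A (x, \<omega>) \<partial>K \<omega>)"
        by simp
    qed
    finally show ?case .
  next
    case (mult u c)
    have "(\<lambda>\<omega>. c * (\<integral>\<^sup>+x. u (x, \<omega>) \<partial>K \<omega>)) \<in> borel_measurable M"
      using mult by (intro borel_measurable_times_ennreal) auto
    also have "?this \<longleftrightarrow> ?case"
      using sec[OF mult(2)] by (intro measurable_cong) (simp add: nn_integral_cmult)
    finally show ?case .
  next
    case (add u v)
    have "(\<lambda>\<omega>. (\<integral>\<^sup>+x. v (x, \<omega>) \<partial>K \<omega>) + (\<integral>\<^sup>+x. u (x, \<omega>) \<partial>K \<omega>)) \<in> borel_measurable M"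
      using add by (intro borel_measurable_add) auto
    also have "?this \<longleftrightarrow> ?case"
      using sec add by (intro measurable_cong) (simp add: nn_integral_add)
    finally show ?case .
  next
    case (seq U)
    have "(\<lambda>\<omega>. SUP i. \<integral>\<^sup>+x. U i (x, \<omega>) \<partial>K \<omega>) \<in> borel_measurable M"
      using seq by (intro borel_measurable_SUP) auto
    also have "?this \<longleftrightarrow> ?case"
      using sec seq
      by (intro measurable_cong)
        (auto simp: nn_integral_monotone_convergence_SUP[symmetric] incseq_def le_fun_def image_comp)
    finally show ?case .
  qed
qed

section \<open>Adding a unit point mass\<close>

lemma emeasure_add_return:
  assumes "\<mu> \<in> point_measures" "B \<in> sets borel"
  shows "emeasure (add_measure \<mu> (return borel x)) B = emeasure \<mu> B + indicator B x"
  using assms by (simp add: emeasure_add_measure sets_point_measure)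

lemma add_return_in_point_measures:
  assumes \<mu>: "\<mu> \<in> point_measures"
  shows "add_measure \<mu> (return borel x) \<in> point_measures"
proof -
  have "emeasure \<mu> B + indicator B x \<in> range of_nat \<union> {\<infinity>}" if "B \<in> sets borel" for B
  proof -
    have "emeasure \<mu> B \<in> range of_nat \<union> {\<infinity>}"
      using \<mu> that by (auto simp: point_measures_def)
    moreover have "(of_nat n :: ennreal) + 1 \<in> range of_nat" for n
      by (rule range_eqI[of _ _ "Suc n"]) (simp add: add.commute)
    ultimately show ?thesis by (auto simp: indicator_def)
  qed
  moreover have "emeasure \<mu> B + indicator B x < \<infinity>" if "B \<in> sets borel" "bounded B" for B
    using emeasure_radon_finite[OF point_measure_radon[OF \<mu>] that] by (simp add: indicator_def)
  ultimately show ?thesis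
    unfolding point_measures_def radon_measures_def
    using \<mu> by (simp add: emeasure_add_return sets_add_measure sets_point_measure)
qed

text \<open>Composing a test function with this map gives the integrand on the right of the
  Papangelou relation. Joint measurability holds because the evaluation of the second component at
  \<open>B\<close> is the evaluation of \<open>\<mu>\<close> plus the indicator of \<open>B\<close>
  at \<open>x\<close>.\<close>

lemma measurable_add_return:
  "(\<lambda>(x :: 'a::polish_space, \<mu>). (x, add_measure \<mu> (return borel x)))
    \<in> measurable (borel \<Otimes>\<^sub>M point_algebra) (borel \<Otimes>\<^sub>M point_algebra)"
proof -
  have "(\<lambda>p :: 'a \<times> 'a measure. add_measure (snd p) (return borel (fst p)))
      \<in> measurable (borel \<Otimes>\<^sub>M point_algebra) point_algebra"
  proof (rule measurable_point_algebra)
    fix p :: "'a \<times> 'a measure" assume "p \<in> space (borel \<Otimes>\<^sub>M point_algebra)"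
    then show "add_measure (snd p) (return borel (fst p)) \<in> point_measures"
      by (auto simp: space_pair_measure space_point_algebra intro!: add_return_in_point_measures)
  next
    fix B :: "'a set" assume B: "B \<in> sets borel"
    have "(\<lambda>p. emeasure (snd p) B + indicator B (fst p)) \<in> borel_measurable (borel \<Otimes>\<^sub>M point_algebra)"
      using B by (intro borel_measurable_add
          measurable_compose[OF measurable_snd measurable_emeasure_point_algebra]
          measurable_compose[OF measurable_fst] borel_measurable_indicator) auto
    also have "?this \<longleftrightarrow> (\<lambda>p. emeasure (add_measure (snd p) (return borel (fst p))) B)
        \<in> borel_measurable (borel \<Otimes>\<^sub>M point_algebra)"
      using B by (intro measurable_cong)
        (auto simp: space_pair_measure space_point_algebra emeasure_add_return)
    finally show "(\<lambda>p. emeasure (add_measure (snd p) (return borel (fst p))) B)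
        \<in> borel_measurable (borel \<Otimes>\<^sub>M point_algebra)" .
  qed
  then show ?thesis
    by (simp add: case_prod_beta measurable_Pair)
qed

section \<open>Images of point measures and of kernels under \<open>G\<close>\<close>

lemma emeasure_image_measure:
  assumes "G \<in> borel_measurable borel" "\<mu> \<in> radon_measures" "B \<in> sets borel"
  shows "emeasure (image_measure G \<mu>) B = emeasure \<mu> (G -` B)"
proof -
  have "G \<in> measurable \<mu> borel"
    using assms(1) sets_radon[OF assms(2)] by (simp cong: measurable_cong_sets)
  then show ?thesis
    using assms by (simp add: image_measure_def emeasure_distr space_radon)
qed

lemma vimage_borel:
  assumes "G \<in> borel_measurable borel" "B \<in> sets borel"
  shows "G -` B \<in> sets borel"
  using measurable_sets[OF assms] by simp

text \<open>Integer values are inherited through preimages; finiteness on bounded sets is where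
  properness of \<open>G\<close> enters, since it keeps preimages of bounded Borel sets
  bounded.\<close>

lemma image_in_point_measures:
  assumes G: "G \<in> borel_measurable borel" "bounded_proper G"
    and \<mu>: "\<mu> \<in> point_measures"
  shows "image_measure G \<mu> \<in> point_measures"
proof -
  have "emeasure \<mu> (G -` B) \<in> range of_nat \<union> {\<infinity>}" if "B \<in> sets borel" for B
    using \<mu> vimage_borel[OF G(1) that] unfolding point_measures_def by blast
  moreover have "emeasure \<mu> (G -` B) < \<infinity>" if "B \<in> sets borel" "bounded B" for B
    using G(2) that emeasure_radon_finite[OF point_measure_radon[OF \<mu>]]
    by (simp add: bounded_proper_def)
  moreover have "sets (image_measure G \<mu>) = sets borel"
    by (simp add: image_measure_def)
  ultimately show ?thesis
    unfolding point_measures_def radon_measures_def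
    by (simp add: emeasure_image_measure[OF G(1) point_measure_radon[OF \<mu>]])
qed

lemma measurable_image_measure:
  assumes G: "G \<in> borel_measurable borel" "bounded_proper G"
  shows "image_measure G \<in> measurable point_algebra point_algebra"
proof (rule measurable_point_algebra)
  fix B assume B: "B \<in> sets (borel :: 'b measure)"
  have "(\<lambda>\<mu>. emeasure \<mu> (G -` B)) \<in> borel_measurable point_algebra"
    using vimage_borel[OF G(1) B] by (rule measurable_emeasure_point_algebra)
  also have "?this \<longleftrightarrow> (\<lambda>\<mu>. emeasure (image_measure G \<mu>) B) \<in> borel_measurable point_algebra"
    using B G by (intro measurable_cong)
      (simp add: emeasure_image_measure space_point_algebra point_measure_radon)
  finally show "(\<lambda>\<mu>. emeasure (image_measure G \<mu>) B) \<in> borel_measurable point_algebra" .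
qed (use G in \<open>simp add: space_point_algebra image_in_point_measures\<close>)

text \<open>On a Borel set \<open>B\<close> both sides give the \<open>\<mu>\<close>-mass of the
  preimage of \<open>B\<close> plus the indicator of \<open>B\<close> at \<open>G x\<close>.\<close>

lemma image_measure_add_return:
  assumes G: "G \<in> borel_measurable borel" "bounded_proper G"
    and \<mu>: "\<mu> \<in> point_measures"
  shows "image_measure G (add_measure \<mu> (return borel x)) =
    add_measure (image_measure G \<mu>) (return borel (G x))"
proof (rule measure_eqI)
  show "sets (image_measure G (add_measure \<mu> (return borel x))) =
      sets (add_measure (image_measure G \<mu>) (return borel (G x)))"
    by (simp add: image_measure_def sets_add_measure)
next
  fix B assume "B \<in> sets (image_measure G (add_measure \<mu> (return borel x)))"
  then have B: "B \<in> sets borel" by (simp add: image_measure_def)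
  show "emeasure (image_measure G (add_measure \<mu> (return borel x))) B =
      emeasure (add_measure (image_measure G \<mu>) (return borel (G x))) B"
    using assms B vimage_borel[OF G(1) B]
    by (simp add: emeasure_image_measure emeasure_add_return image_in_point_measures
        point_measure_radon add_return_in_point_measures)
      (simp add: indicator_def)
qed

lemma nn_integral_image_measure:
  assumes G: "G \<in> borel_measurable borel" and \<mu>: "\<mu> \<in> radon_measures"
    and f: "f \<in> borel_measurable borel"
  shows "(\<integral>\<^sup>+y. f y \<partial>image_measure G \<mu>) = (\<integral>\<^sup>+x. f (G x) \<partial>\<mu>)"
proof -
  have "G \<in> measurable \<mu> borel"
    using G sets_radon[OF \<mu>] by (simp cong: measurable_cong_sets)
  then show ?thesis
    using f by (simp add: image_measure_def nn_integral_distr)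
qed

text \<open>Upgrades the setwise prescription of \<open>\<pi>'\<close> to an equality of measures,
  so that integrals against \<open>\<pi>'\<close> can be rewritten by change of variables. Equality
  of the sigma-fields comes from \<open>\<pi>'\<close> being a Radon kernel.\<close>

lemma image_kernel_eq_image_measure:
  assumes G: "G \<in> borel_measurable borel" "bounded_proper G"
    and \<pi>: "radon_kernel \<pi>" and \<pi>': "image_kernel G \<pi> \<pi>'" and \<mu>: "\<mu> \<in> point_measures"
  shows "\<pi>' (image_measure G \<mu>) = image_measure G (\<pi> \<mu>)"
proof (rule measure_eqI)
  note im = image_in_point_measures[OF G \<mu>]
  have "\<pi>' (image_measure G \<mu>) \<in> radon_measures"
    using \<pi>' im by (auto simp: image_kernel_def radon_kernel_def)
  then show eq: "sets (\<pi>' (image_measure G \<mu>)) = sets (image_measure G (\<pi> \<mu>))"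
    by (simp add: sets_radon image_measure_def)
  fix B assume "B \<in> sets (\<pi>' (image_measure G \<mu>))"
  then have B: "B \<in> sets borel" using eq by (simp add: image_measure_def)
  have "\<pi> \<mu> \<in> radon_measures" using \<pi> \<mu> by (auto simp: radon_kernel_def)
  then show "emeasure (\<pi>' (image_measure G \<mu>)) B = emeasure (image_measure G (\<pi> \<mu>)) B"
    using \<pi>' im \<mu> B by (simp add: image_kernel_def emeasure_image_measure[OF G(1)])
qed

section \<open>Transfer of the Papangelou relation along \<open>G\<close>\<close>

theorem theorem3p6:
  fixes G :: "'a::polish_space \<Rightarrow> 'b::polish_space"
    and \<pi> :: "'a measure \<Rightarrow> 'a measure"
    and \<pi>' :: "'b measure \<Rightarrow> 'b measure"
    and P :: "'a measure measure"
  assumes "G \<in> borel_measurable borel"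
    and "bounded_proper G"
    and "surj G"
    and "papangelou_kernel \<pi>"
    and "dynkin_condition G \<pi>"
    and "image_kernel G \<pi> \<pi>'"
    and "P \<in> papangelou_processes \<pi>"
  shows "image_process G P \<in> papangelou_processes \<pi>'"
proof -
  note G = assms(1,2)
  have \<pi>: "radon_kernel \<pi>" and P: "sets P = sets point_algebra" "prob_space P"
    and papangelou: "\<And>h. h \<in> borel_measurable (borel \<Otimes>\<^sub>M point_algebra) \<Longrightarrow>
      (\<integral>\<^sup>+\<mu>. (\<integral>\<^sup>+x. h (x, \<mu>) \<partial>\<mu>) \<partial>P) =
      (\<integral>\<^sup>+\<mu>. (\<integral>\<^sup>+x. h (x, add_measure \<mu> (return borel x)) \<partial>\<pi> \<mu>) \<partial>P)"
    using assms(7) by (auto simp: papangelou_processes_def point_process_def)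
  have \<pi>': "radon_kernel \<pi>'" using assms(6) by (simp add: image_kernel_def)
  have space_P: "space P = point_measures"
    using sets_eq_imp_space_eq[OF P(1)] by (simp add: space_point_algebra)
  have GP: "image_measure G \<in> measurable P point_algebra"
    using measurable_image_measure[OF G] P(1) by (simp cong: measurable_cong_sets)
  have "point_process (image_process G P)"
    using prob_space.prob_space_distr[OF P(2) GP] by (simp add: point_process_def image_process_def)
  moreover have "(\<integral>\<^sup>+\<nu>. (\<integral>\<^sup>+y. h (y, \<nu>) \<partial>\<nu>) \<partial>image_process G P) =
      (\<integral>\<^sup>+\<nu>. (\<integral>\<^sup>+y. h (y, add_measure \<nu> (return borel y)) \<partial>\<pi>' \<nu>) \<partial>image_process G P)"
    if h: "h \<in> borel_measurable (borel \<Otimes>\<^sub>M point_algebra)" for h :: "'b \<times> 'b measure \<Rightarrow> ennreal"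
  proof -
    \<comment> \<open>The integrand of the right-hand side on the target space, as a function of
      point and configuration jointly.\<close>
    let ?h = "\<lambda>p. h (fst p, add_measure (snd p) (return borel (fst p)))"
    have h': "?h \<in> borel_measurable (borel \<Otimes>\<^sub>M point_algebra)"
      using measurable_compose[OF measurable_add_return h] by (simp add: case_prod_beta)
    \<comment> \<open>The pullback of \<open>h\<close> to the source space; this is the test
      function to which the relation for \<open>P\<close> is applied.\<close>
    have hG: "(\<lambda>p. h (G (fst p), image_measure G (snd p))) \<in> borel_measurable (borel \<Otimes>\<^sub>M point_algebra)"
      by (intro measurable_compose[OF _ h] measurable_Pair
          measurable_compose[OF measurable_fst G(1)]
          measurable_compose[OF measurable_snd measurable_image_measure[OF G]])
    \<comment> \<open>Outer change of variables. The inner integral must be measurable in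
      \<open>\<nu>\<close>, which is the kernel lemma for the tautological kernel on
      \<open>point_algebra\<close>.\<close>
    have "(\<integral>\<^sup>+\<nu>. (\<integral>\<^sup>+y. h (y, \<nu>) \<partial>\<nu>) \<partial>image_process G P) =
        (\<integral>\<^sup>+\<mu>. (\<integral>\<^sup>+y. h (y, image_measure G \<mu>) \<partial>image_measure G \<mu>) \<partial>P)"
      unfolding image_process_def
      by (intro nn_integral_distr[OF GP])
        (auto intro!: measurable_nn_integral_kernel[OF _ _ h] measurable_emeasure_point_algebra
          simp: space_point_algebra point_measure_radon)
    \<comment> \<open>Inner change of variables, with the configuration held fixed at
      \<open>image_measure G \<mu>\<close>.\<close>
    also have "\<dots> = (\<integral>\<^sup>+\<mu>. (\<integral>\<^sup>+x. h (G x, image_measure G \<mu>) \<partial>\<mu>) \<partial>P)"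
      using measurable_Pair1[OF h] image_in_point_measures[OF G]
      by (intro nn_integral_cong nn_integral_image_measure[OF G(1)])
        (auto simp: space_P point_measure_radon space_point_algebra)
    \<comment> \<open>The Papangelou relation of \<open>P\<close> enters here: the configuration
      gains a point before \<open>G\<close> is applied, and the next equality moves that point
      through \<open>G\<close>.\<close>
    also have "\<dots> = (\<integral>\<^sup>+\<mu>. (\<integral>\<^sup>+x. h (G x, image_measure G (add_measure \<mu> (return borel x))) \<partial>\<pi> \<mu>) \<partial>P)"
      using papangelou[OF hG] by simp
    also have "\<dots> = (\<integral>\<^sup>+\<mu>. (\<integral>\<^sup>+x. ?h (G x, image_measure G \<mu>) \<partial>\<pi> \<mu>) \<partial>P)"
      by (intro nn_integral_cong) (simp add: space_P image_measure_add_return[OF G])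
    \<comment> \<open>The inner change of variables read backwards, now for
      \<open>\<pi> \<mu>\<close>, whose image under \<open>G\<close> is
      \<open>\<pi>' (image_measure G \<mu>)\<close>.\<close>
    also have "\<dots> = (\<integral>\<^sup>+\<mu>. (\<integral>\<^sup>+y. ?h (y, image_measure G \<mu>) \<partial>\<pi>' (image_measure G \<mu>)) \<partial>P)"
    proof (rule nn_integral_cong)
      fix \<mu> assume "\<mu> \<in> space P"
      then have \<mu>: "\<mu> \<in> point_measures" by (simp add: space_P)
      then have "\<pi> \<mu> \<in> radon_measures" using \<pi> by (simp add: radon_kernel_def)
      moreover have "(\<lambda>y. ?h (y, image_measure G \<mu>)) \<in> borel_measurable borel"
        using measurable_Pair1[OF h'] image_in_point_measures[OF G \<mu>] by (simp add: space_point_algebra)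
      ultimately show "(\<integral>\<^sup>+x. ?h (G x, image_measure G \<mu>) \<partial>\<pi> \<mu>) =
          (\<integral>\<^sup>+y. ?h (y, image_measure G \<mu>) \<partial>\<pi>' (image_measure G \<mu>))"
        unfolding image_kernel_eq_image_measure[OF G \<pi> assms(6) \<mu>]
        by (rule nn_integral_image_measure[OF G(1), symmetric])
    qed
    \<comment> \<open>The outer change of variables read backwards; measurability in
      \<open>\<nu>\<close> is now the kernel lemma for \<open>\<pi>'\<close>, on all of
      \<open>point_measures\<close> and not only on images under \<open>G\<close>.\<close>
    also have "\<dots> = (\<integral>\<^sup>+\<nu>. (\<integral>\<^sup>+y. ?h (y, \<nu>) \<partial>\<pi>' \<nu>) \<partial>image_process G P)"
    proof -
      have "(\<lambda>\<nu>. \<integral>\<^sup>+y. ?h (y, \<nu>) \<partial>\<pi>' \<nu>) \<in> borel_measurable point_algebra"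
        using \<pi>' by (intro measurable_nn_integral_kernel[OF _ _ h'])
          (simp_all add: space_point_algebra radon_kernel_def)
      then show ?thesis
        unfolding image_process_def by (intro nn_integral_distr[OF GP, symmetric]) simp
    qed
    finally show ?thesis by simp
  qed
  ultimately show ?thesis
    using \<pi>' unfolding papangelou_processes_def by blast
qed

end
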